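(* Let $\tau$ be a trivolution on a complex algebra $A$, let $(\lambda_0,x_0)\in A^\sharp=\mathbb C\times A$, and define $\tau^\sharp\colon A^\sharp\to A^\sharp$ by $$\tau^\sharp(\lambda,x)=(\overline\lambda\lambda_0,\ \overline\lambda x_0+\tau(x)).$$ Then $\tau^\sharp$ is a trivolution on $A^\sharp$ extending $\tau$ if and only if either of the following conditions holds: (i) $\tau^\sharp(\lambda,x)=(\overline\lambda,\ \overline\lambda x_0+\tau(x))$ for all $(\lambda,x)\in A^\sharp$, where $x_0\in A$ is such that $$x_0^2=-x_0,\qquad x_0\tau(A)=\tau(A)x_0=\{0\},\qquad \tau(x_0)=0;$$ (ii) $\tau^\sharp(\lambda,x)=(0,\ \overline\lambda x_0+\tau(x))$ for all $(\lambda,x)\in A^\sharp$, where $x_0\in\tau(A)$ is the identity of $\tau(A)$.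
   Context: A trivolution on a complex algebra $A$ is a non-zero conjugate-linear anti-homomorphism $\tau\colon A\to A$ (so $\tau(xy)=\tau(y)\tau(x)$) such that $\tau^3=\tau\circ\tau\circ\tau=\tau$. Here algebras are considered without norms. $A^\sharp=\mathbb C\times A$ is the unitized algebra, with product $(\lambda,x)(\mu,y)=(\lambda\mu,\lambda y+\mu x+xy)$ and identity $(1,0)$ (formed whether or not $A$ has an identity). A trivolution $\tau^\sharp$ on $A^\sharp$ extends $\tau$ if $\tau^\sharp(0,x)=(0,\tau(x))$ for all $x\in A$. (By conjugate linearity any such extension has the displayed form with $(\lambda_0,x_0)=\tau^\sharp(1,0)$.) *)

theory Defs
  imports Complex_Main
begin

text \<open>
  Complex analogues of the type classes \<^class>\<open>real_vector\<close> and \<^class>\<open>real_algebra\<close>.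
  As in \<^class>\<open>real_algebra\<close>, the multiplication is associative and there need not be an identity.
\<close>

class scaleC =
  fixes scaleC :: "complex \<Rightarrow> 'a \<Rightarrow> 'a"  (infixr \<open>*\<^sub>C\<close> 75)

class complex_vector = scaleC + ab_group_add +
  assumes scaleC_add_right: "a *\<^sub>C (x + y) = a *\<^sub>C x + a *\<^sub>C y"
    and scaleC_add_left: "(a + b) *\<^sub>C x = a *\<^sub>C x + b *\<^sub>C x"
    and scaleC_scaleC: "a *\<^sub>C b *\<^sub>C x = (a * b) *\<^sub>C x"
    and scaleC_one: "1 *\<^sub>C x = x"

class complex_algebra = complex_vector + ring +
  assumes mult_scaleC_left: "(a *\<^sub>C x) * y = a *\<^sub>C (x * y)"
    and mult_scaleC_right: "x * (a *\<^sub>C y) = a *\<^sub>C (x * y)"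

global_interpretation complex_vector:
  vector_space "scaleC :: complex \<Rightarrow> 'a \<Rightarrow> 'a::complex_vector"
  by standard (simp_all add: scaleC_add_right scaleC_add_left scaleC_scaleC scaleC_one)

text \<open>
  The unitized algebra. A type of its own, rather than \<open>complex \<times> 'a\<close>, so that it can be
  given the unitization product as its ring structure.
\<close>

datatype 'a unitization = Unitization (scalar_part: complex) (algebra_part: 'a)

instantiation unitization :: (complex_algebra) complex_algebra
begin

definition "0 = Unitization 0 0"

definition "u + v =
  Unitization (scalar_part u + scalar_part v) (algebra_part u + algebra_part v)"

definition "- u = Unitization (- scalar_part u) (- algebra_part u)"

definition "u - v =
  Unitization (scalar_part u - scalar_part v) (algebra_part u - algebra_part v)"

definition "a *\<^sub>C u = Unitization (a * scalar_part u) (a *\<^sub>C algebra_part u)"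

definition "u * v =
  Unitization (scalar_part u * scalar_part v)
    (scalar_part u *\<^sub>C algebra_part v + scalar_part v *\<^sub>C algebra_part u
      + algebra_part u * algebra_part v)"

instance
  by standard
    (simp_all add: zero_unitization_def plus_unitization_def uminus_unitization_def
      minus_unitization_def scaleC_unitization_def times_unitization_def algebra_simps
      mult_scaleC_left mult_scaleC_right complex_vector.scale_right_distrib
      complex_vector.scale_left_distrib)

end

instantiation unitization :: (complex_algebra) ring_1
begin

definition "1 = Unitization 1 0"

instance
  by standard
    (auto simp: one_unitization_def zero_unitization_def times_unitization_def)

end

definition conj_linear :: "('a::complex_vector \<Rightarrow> 'b::complex_vector) \<Rightarrow> bool" where
  "conj_linear f \<longleftrightarrow>
    (\<forall>x y. f (x + y) = f x + f y) \<and> (\<forall>a x. f (a *\<^sub>C x) = cnj a *\<^sub>C f x)"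

definition trivolution :: "('a::complex_algebra \<Rightarrow> 'a) \<Rightarrow> bool" where
  "trivolution \<tau> \<longleftrightarrow>
    (\<exists>x. \<tau> x \<noteq> 0) \<and> conj_linear \<tau> \<and> (\<forall>x y. \<tau> (x * y) = \<tau> y * \<tau> x) \<and> \<tau> \<circ> \<tau> \<circ> \<tau> = \<tau>"

definition extends_to_unitization ::
    "('a::complex_algebra unitization \<Rightarrow> 'a unitization) \<Rightarrow> ('a \<Rightarrow> 'a) \<Rightarrow> bool" where
  "extends_to_unitization \<tau>s \<tau> \<longleftrightarrow> (\<forall>x. \<tau>s (Unitization 0 x) = Unitization 0 (\<tau> x))"

definition is_identity_of :: "'a::complex_algebra \<Rightarrow> 'a set \<Rightarrow> bool" where
  "is_identity_of e B \<longleftrightarrow> e \<in> B \<and> (\<forall>y\<in>B. e * y = y \<and> y * e = y)"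

end

theory Submission
  imports Defs
begin

text \<open>
  As a vector space, the unitization is spanned by its identity and the copy of \<open>A\<close>, on which
  \<open>\<tau>s\<close> restricts to the given trivolution \<open>\<tau>\<close>. Whether \<open>\<tau>s\<close> is a trivolution is therefore a
  question about the single element \<open>e = \<tau>s 1 = (l0, x0)\<close>: reversing products means that \<open>e\<close> is
  idempotent and acts as a two-sided identity on \<open>\<tau>(A)\<close>, and \<open>\<tau>s \<circ> \<tau>s \<circ> \<tau>s = \<tau>s\<close> means that
  \<open>\<tau>s (\<tau>s e) = e\<close>. This is lemma \<open>trivolution_unitization_iff\<close>, with the conditions spelled out
  in the coordinates \<open>l0\<close> and \<open>x0\<close>.

  Idempotency forces \<open>l0\<close> to be \<open>0\<close> or \<open>1\<close>. If \<open>l0 = 0\<close>, then \<open>x0\<close> itself acts as an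
  identity on \<open>\<tau>(A)\<close>, and \<open>\<tau>s (\<tau>s e) = e\<close> reduces to \<open>\<tau> (\<tau> x0) = x0\<close>, which is membership in
  \<open>\<tau>(A)\<close>. If \<open>l0 = 1\<close>, then \<open>- x0\<close> is an idempotent annihilated by \<open>\<tau>(A)\<close> on both sides, and
  \<open>\<tau>s (\<tau>s e) = e\<close> only says \<open>\<tau> x0 + \<tau> (\<tau> x0) = 0\<close>; the stronger \<open>\<tau> x0 = 0\<close> comes from the
  multiplicative conditions (lemma \<open>trivolution_annihilated_eq_0\<close>).
\<close>

lemma conj_linear_add: "conj_linear f \<Longrightarrow> f (x + y) = f x + f y"
  by (simp add: conj_linear_def)

lemma conj_linear_scaleC: "conj_linear f \<Longrightarrow> f (a *\<^sub>C x) = cnj a *\<^sub>C f x"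
  by (simp add: conj_linear_def)

lemma conj_linear_0: "conj_linear f \<Longrightarrow> f 0 = 0"
  using conj_linear_add[of f 0 0] by simp

lemma conj_linear_minus:
  assumes "conj_linear f"
  shows "f (- x) = - f x"
  using conj_linear_add[OF assms, of x "- x"] conj_linear_0[OF assms]
  by (simp add: eq_neg_iff_add_eq_0 add.commute)

lemma trivolution_conj_linear: "trivolution \<tau> \<Longrightarrow> conj_linear \<tau>"
  by (simp add: trivolution_def)

lemma trivolution_mult: "trivolution \<tau> \<Longrightarrow> \<tau> (x * y) = \<tau> y * \<tau> x"
  by (simp add: trivolution_def)

lemma trivolution_cubed: "trivolution \<tau> \<Longrightarrow> \<tau> (\<tau> (\<tau> x)) = \<tau> x"
  by (auto simp: trivolution_def fun_eq_iff)

lemma range_trivolution_iff: "trivolution \<tau> \<Longrightarrow> x \<in> range \<tau> \<longleftrightarrow> \<tau> (\<tau> x) = x"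
  by (metis rangeE rangeI trivolution_cubed)

text \<open>
  With \<open>e = \<tau> x\<close>, the hypotheses give \<open>\<tau> e = - e\<close> and \<open>e = - e * e\<close>. Applying \<open>\<tau>\<close> to
  \<open>x * e = 0\<close> turns it into \<open>\<tau> e * e = 0\<close>, that is \<open>e * e = 0\<close>, hence \<open>e = 0\<close>.
\<close>

lemma trivolution_annihilated_eq_0:
  assumes "trivolution \<tau>" and "x * x = - x" and "x * \<tau> x = 0" and "\<tau> x + \<tau> (\<tau> x) = 0"
  shows "\<tau> x = 0"
proof -
  note lin = trivolution_conj_linear[OF assms(1)]
  have "\<tau> (\<tau> x) * \<tau> x = 0"
    using trivolution_mult[OF assms(1), of x "\<tau> x"] assms(3) conj_linear_0[OF lin] by simp
  moreover have "\<tau> (\<tau> x) = - \<tau> x"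
    using assms(4) by (simp add: eq_neg_iff_add_eq_0 add.commute)
  ultimately have "\<tau> x * \<tau> x = 0"
    by simp
  moreover have "\<tau> x * \<tau> x = - \<tau> x"
    using trivolution_mult[OF assms(1), of x x] assms(2) conj_linear_minus[OF lin] by simp
  ultimately show ?thesis
    by simp
qed

lemma conj_linear_unitization:
  fixes \<tau> :: "'a::complex_algebra \<Rightarrow> 'a" and F :: "'a unitization \<Rightarrow> 'a unitization"
  assumes "conj_linear \<tau>"
    and F: "\<And>l x. F (Unitization l x) = Unitization (cnj l * l0) (cnj l *\<^sub>C x0 + \<tau> x)"
  shows "conj_linear F"
  unfolding conj_linear_def
proof (intro conjI allI)
  fix u v :: "'a unitization" and a :: complex
  show "F (u + v) = F u + F v"
    by (cases u; cases v)
      (simp add: F plus_unitization_def conj_linear_add[OF assms(1)] scaleC_add_left algebra_simps)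
  show "F (a *\<^sub>C u) = cnj a *\<^sub>C F u"
    by (cases u)
      (simp add: F scaleC_unitization_def conj_linear_scaleC[OF assms(1)] scaleC_add_right
        scaleC_scaleC algebra_simps)
qed

text \<open>
  By conjugate-linearity, each condition on \<open>F\<close> need only be tested on the identity and on the
  copy of the algebra, where \<open>F\<close> already behaves like \<open>\<tau>\<close>. The first two conjuncts say that
  \<open>F 1\<close> is idempotent, the third that it acts as an identity on the range of \<open>\<tau>\<close>. Given these,
  \<open>l0\<close> is real, and the last conjunct is the second coordinate of \<open>F (F (F 1)) = F 1\<close>.
\<close>

lemma trivolution_unitization_iff:
  fixes \<tau> :: "'a::complex_algebra \<Rightarrow> 'a" and F :: "'a unitization \<Rightarrow> 'a unitization"
  assumes \<tau>: "trivolution \<tau>"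
    and F: "\<And>l x. F (Unitization l x) = Unitization (cnj l * l0) (cnj l *\<^sub>C x0 + \<tau> x)"
  shows "trivolution F \<longleftrightarrow>
    l0 * l0 = l0 \<and> l0 *\<^sub>C x0 + l0 *\<^sub>C x0 + x0 * x0 = x0 \<and>
    (\<forall>x. l0 *\<^sub>C \<tau> x + x0 * \<tau> x = \<tau> x \<and> l0 *\<^sub>C \<tau> x + \<tau> x * x0 = \<tau> x) \<and>
    l0 *\<^sub>C x0 + \<tau> (l0 *\<^sub>C x0 + \<tau> x0) = x0" (is "_ \<longleftrightarrow> ?R")
proof -
  note lin = trivolution_conj_linear[OF \<tau>]
  note linF = conj_linear_unitization[OF lin F]
  have F1: "F 1 = Unitization l0 x0"
    and FA: "\<And>x. F (Unitization 0 x) = Unitization 0 (\<tau> x)"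
    using conj_linear_0[OF lin] by (simp_all add: F one_unitization_def)
  have idem_real: "cnj l0 = l0" if "l0 * l0 = l0"
    using that by auto
  show ?thesis
  proof
    assume L: "trivolution F"
    have 1: "Unitization l0 x0 * Unitization l0 x0 = Unitization l0 x0"
      using trivolution_mult[OF L, of 1 1]
      by (simp add: F1)
    have 2: "Unitization l0 x0 * Unitization 0 (\<tau> x) = Unitization 0 (\<tau> x)"
      and 3: "Unitization 0 (\<tau> x) * Unitization l0 x0 = Unitization 0 (\<tau> x)" for x
      using trivolution_mult[OF L, of "Unitization 0 x" 1]
        trivolution_mult[OF L, of 1 "Unitization 0 x"]
      by (simp_all add: F1 FA)
    have idem: "l0 * l0 = l0"
      using 1 by (simp add: times_unitization_def)
    have 4: "F (F (Unitization l0 x0)) = Unitization l0 x0"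
      using trivolution_cubed[OF L, of 1] by (simp add: F1)
    show ?R
      using 1 2 3 4 idem idem_real[OF idem] by (simp add: F times_unitization_def)
  next
    assume R: ?R
    then have idem: "l0 * l0 = l0"
      and sq: "x0 * x0 = x0 - l0 *\<^sub>C x0 - l0 *\<^sub>C x0"
      and left: "\<And>x. x0 * \<tau> x = \<tau> x - l0 *\<^sub>C \<tau> x"
      and right: "\<And>x. \<tau> x * x0 = \<tau> x - l0 *\<^sub>C \<tau> x"
      and cubed: "l0 *\<^sub>C x0 + \<tau> (l0 *\<^sub>C x0 + \<tau> x0) = x0"
      by (simp_all add: algebra_simps)
    note real = idem_real[OF idem]
    \<comment> \<open>Every product of \<open>x0\<close> with itself or with a value of \<open>\<tau>\<close> can be rewritten without a
      product, after which both sides are linear combinations of \<open>x0\<close>, the values of \<open>\<tau>\<close> and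
      their products.\<close>
    have mult: "F (u * v) = F v * F u" for u v
      by (cases u; cases v)
        (simp add: F times_unitization_def conj_linear_add[OF lin] conj_linear_scaleC[OF lin]
          trivolution_mult[OF \<tau>] distrib_left distrib_right mult_scaleC_left mult_scaleC_right
          sq left right scaleC_add_right scaleC_scaleC idem mult.assoc mult.left_commute
          complex_vector.scale_right_diff_distrib; simp add: algebra_simps idem)
    have "F (F (F 1)) = F 1"
      using cubed by (simp add: F1 F idem real)
    moreover have "F (F (F (Unitization 0 x))) = F (Unitization 0 x)" for x
      by (simp add: FA trivolution_cubed[OF \<tau>])
    ultimately have "F (F (F (l *\<^sub>C 1 + Unitization 0 x))) = F (l *\<^sub>C 1 + Unitization 0 x)" for l x
      by (simp only: conj_linear_add[OF linF] conj_linear_scaleC[OF linF] complex_cnj_cnj)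
    moreover have "l *\<^sub>C 1 + Unitization 0 x = Unitization l x" for l and x :: 'a
      by (simp add: plus_unitization_def scaleC_unitization_def one_unitization_def)
    ultimately have cubedF: "F (F (F (Unitization l x))) = F (Unitization l x)" for l x
      by simp
    have "F (F (F u)) = F u" for u
      using cubedF by (cases u) simp
    then have "F \<circ> F \<circ> F = F"
      by (simp add: fun_eq_iff)
    moreover have "\<exists>u. F u \<noteq> 0"
    proof -
      obtain x where "\<tau> x \<noteq> 0"
        using \<tau> by (auto simp: trivolution_def)
      then have "F (Unitization 0 x) \<noteq> 0"
        by (simp add: FA zero_unitization_def)
      then show ?thesis ..
    qed
    ultimately show "trivolution F"
      using linF mult by (simp add: trivolution_def)
  qed
qed

theorem theorem2p10:
  fixes \<tau> :: "'a::complex_algebra \<Rightarrow> 'a"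
    and \<tau>s :: "'a unitization \<Rightarrow> 'a unitization"
    and l0 :: complex and x0 :: 'a
  assumes "trivolution \<tau>"
    and "\<And>l x. \<tau>s (Unitization l x) = Unitization (cnj l * l0) (cnj l *\<^sub>C x0 + \<tau> x)"
  shows "trivolution \<tau>s \<and> extends_to_unitization \<tau>s \<tau> \<longleftrightarrow>
    ((\<forall>l x. \<tau>s (Unitization l x) = Unitization (cnj l) (cnj l *\<^sub>C x0 + \<tau> x)) \<and>
      x0 * x0 = - x0 \<and>
      (\<lambda>y. x0 * y) ` range \<tau> = {0} \<and> (\<lambda>y. y * x0) ` range \<tau> = {0} \<and> \<tau> x0 = 0) \<or>
    ((\<forall>l x. \<tau>s (Unitization l x) = Unitization 0 (cnj l *\<^sub>C x0 + \<tau> x)) \<and>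
      x0 \<in> range \<tau> \<and> is_identity_of x0 (range \<tau>))"
    (is "?T \<longleftrightarrow> ?i \<or> ?ii")
proof -
  note \<tau> = assms(1) and \<tau>s = assms(2)
  have ext: "extends_to_unitization \<tau>s \<tau>"
    by (simp add: extends_to_unitization_def \<tau>s)
  have l1: "(\<forall>l x. \<tau>s (Unitization l x) = Unitization (cnj l) (cnj l *\<^sub>C x0 + \<tau> x)) \<longleftrightarrow> l0 = 1"
    by (auto simp: \<tau>s dest: spec[of _ 1])
  have l0: "(\<forall>l x. \<tau>s (Unitization l x) = Unitization 0 (cnj l *\<^sub>C x0 + \<tau> x)) \<longleftrightarrow> l0 = 0"
    by (auto simp: \<tau>s dest: spec[of _ 1])
  have image_zero: "f ` range \<tau> = {0} \<longleftrightarrow> (\<forall>x. f (\<tau> x) = 0)" for f :: "'a \<Rightarrow> 'a"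
    using subset_singleton_iff[of "f ` range \<tau>" 0] by auto
  have images: "(\<lambda>y. x0 * y) ` range \<tau> = {0} \<longleftrightarrow> (\<forall>x. x0 * \<tau> x = 0)"
    "(\<lambda>y. y * x0) ` range \<tau> = {0} \<longleftrightarrow> (\<forall>x. \<tau> x * x0 = 0)"
    by (simp_all add: image_zero)
  note iff = trivolution_unitization_iff[OF \<tau> \<tau>s]
  consider "l0 = 0" | "l0 = 1" | "l0 * l0 \<noteq> l0"
    by auto
  then show ?thesis
  proof cases
    case 1
    have "trivolution \<tau>s \<longleftrightarrow>
        x0 * x0 = x0 \<and> (\<forall>x. x0 * \<tau> x = \<tau> x \<and> \<tau> x * x0 = \<tau> x) \<and> \<tau> (\<tau> x0) = x0"
      by (simp add: iff 1)
    also have "\<dots> \<longleftrightarrow> x0 \<in> range \<tau> \<and> is_identity_of x0 (range \<tau>)"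
      by (auto simp: is_identity_of_def simp flip: range_trivolution_iff[OF \<tau>])
    finally show ?thesis
      unfolding l1 l0 using 1 ext by simp
  next
    case 2
    have sq: "x0 + x0 + x0 * x0 = x0 \<longleftrightarrow> x0 * x0 = - x0"
      by (simp add: eq_neg_iff_add_eq_0 add.assoc add.commute)
    have "trivolution \<tau>s \<longleftrightarrow> x0 * x0 = - x0 \<and> (\<forall>x. x0 * \<tau> x = 0 \<and> \<tau> x * x0 = 0) \<and>
        \<tau> x0 + \<tau> (\<tau> x0) = 0"
      by (simp add: iff 2 scaleC_one sq conj_linear_add[OF trivolution_conj_linear[OF \<tau>]])
    also have "\<dots> \<longleftrightarrow> x0 * x0 = - x0 \<and> (\<forall>x. x0 * \<tau> x = 0) \<and> (\<forall>x. \<tau> x * x0 = 0) \<and> \<tau> x0 = 0"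
      using trivolution_annihilated_eq_0[OF \<tau>]
        conj_linear_0[OF trivolution_conj_linear[OF \<tau>]] by auto
    finally show ?thesis
      unfolding l1 l0 images using 2 ext by simp
  next
    case 3
    then show ?thesis
      unfolding l1 l0 by (auto simp: iff)
  qed
qed

end
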